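(* Let $\mathbf{X}$ be a finite set of random vectors (features) defined on a common probability space and having finite first moments, and let $\nu^2$ denote distance covariance. For $\mathbf{S} \in 2^{\mathbf{X}}\setminus\{\varnothing,\mathbf{X}\}$ and $X_i \in \mathbf{X}\setminus\mathbf{S}$ define $$\pi(X_i,\mathbf{S}) = \sum_{S_j \in \mathbf{S}} -\nu^2(X_i, S_j).$$ Then $\pi$ is a monotone linkage function, i.e. $\pi(X_i,\mathbf{S}) \ge \pi(X_i,\mathbf{T})$ for all $\mathbf{S} \subseteq \mathbf{T}$ in $2^{\mathbf{X}}\setminus\{\varnothing,\mathbf{X}\}$ and all $X_i \in \mathbf{X}\setminus\mathbf{T}$.
   Context: For random vectors $\mathbf{x}\in\mathbb{R}^d$, $\mathbf{y}\in\mathbb{R}^m$ with finite first moments, the distance covariance is $$\nu^2(\mathbf{x},\mathbf{y}) = \int_{\mathbb{R}^{d+m}} |f_{\mathbf{x},\mathbf{y}}(t,s) - f_{\mathbf{x}}(t) f_{\mathbf{y}}(s)|^2\, w(t,s)\, dt\, ds,$$ where $f_{\mathbf{x}}, f_{\mathbf{y}}$ are the characteristic functions of $\mathbf{x},\mathbf{y}$, $f_{\mathbf{x},\mathbf{y}}$ is their joint characteristic function, and $w$ is the (positive) weight function of Székely, Rizzo and Bakirov, $w(t,s) = \bigl(c_d c_m \|t\|^{1+d}\|s\|^{1+m}\bigr)^{-1}$ with $c_d = \pi^{(1+d)/2}/\Gamma((1+d)/2)$ (in this formula $\pi$ is the number $3.14\ldots$). For random vectors with finite first moments $\nu^2$ is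 a finite non-negative number. *)

theory Defs
  imports "HOL-Probability.Probability"
begin

text \<open>
  The random vectors in one set may have different dimensions, so a vector of
  \<open>\<real>\<^sup>d\<close> is an extensional function on \<open>{..<d}\<close>, i.e. a point of
  \<open>Pi\<^sub>M {..<d} (\<lambda>_. borel)\<close>, and a random vector carries its own dimension.
  The Euclidean norm of \<open>t\<close> is \<open>L2_set t {..<d}\<close>.
\<close>

datatype 'w random_vector = Random_Vector (rv_dim: nat) (rv_fun: "'w \<Rightarrow> nat \<Rightarrow> real")

definition is_random_vector :: "'w measure \<Rightarrow> 'w random_vector \<Rightarrow> bool" where
  "is_random_vector M x \<longleftrightarrow>
     rv_dim x \<ge> 1 \<and> rv_fun x \<in> measurable M (Pi\<^sub>M {..<rv_dim x} (\<lambda>_. borel))"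

definition finite_first_moment :: "'w measure \<Rightarrow> 'w random_vector \<Rightarrow> bool" where
  "finite_first_moment M x \<longleftrightarrow> integrable M (\<lambda>\<omega>. L2_set (rv_fun x \<omega>) {..<rv_dim x})"

definition vec_inner :: "nat \<Rightarrow> (nat \<Rightarrow> real) \<Rightarrow> (nat \<Rightarrow> real) \<Rightarrow> real" where
  "vec_inner d t u = (\<Sum>i<d. t i * u i)"

definition char_fun :: "'w measure \<Rightarrow> 'w random_vector \<Rightarrow> (nat \<Rightarrow> real) \<Rightarrow> complex" where
  "char_fun M x t = (CLINT \<omega>|M. iexp (vec_inner (rv_dim x) t (rv_fun x \<omega>)))"

definition joint_char_fun ::
  "'w measure \<Rightarrow> 'w random_vector \<Rightarrow> 'w random_vector \<Rightarrow>
     (nat \<Rightarrow> real) \<Rightarrow> (nat \<Rightarrow> real) \<Rightarrow> complex" where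
  "joint_char_fun M x y t s =
     (CLINT \<omega>|M. iexp (vec_inner (rv_dim x) t (rv_fun x \<omega>)
                         + vec_inner (rv_dim y) s (rv_fun y \<omega>)))"

definition dcov_const :: "nat \<Rightarrow> real" where
  "dcov_const d = pi powr ((1 + real d) / 2) / Gamma ((1 + real d) / 2)"

text \<open>
  Where \<open>t\<close> or \<open>s\<close> is zero the weight is singular and takes the value \<open>0\<close> here;
  for \<open>d, m \<ge> 1\<close> this is a null set.
\<close>

definition dcov_weight :: "nat \<Rightarrow> nat \<Rightarrow> (nat \<Rightarrow> real) \<Rightarrow> (nat \<Rightarrow> real) \<Rightarrow> real" where
  "dcov_weight d m t s =
     inverse (dcov_const d * dcov_const m
       * L2_set t {..<d} ^ (1 + d) * L2_set s {..<m} ^ (1 + m))"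

text \<open>
  The distance covariance \<open>\<nu>\<^sup>2\<close>; \<open>\<real>\<^sup>d\<^sup>+\<^sup>m\<close> with Lebesgue measure is
  the product of \<open>\<real>\<^sup>d\<close> and \<open>\<real>\<^sup>m\<close>.
\<close>

definition distance_covariance ::
  "'w measure \<Rightarrow> 'w random_vector \<Rightarrow> 'w random_vector \<Rightarrow> real" where
  "distance_covariance M x y =
     (LINT (t, s)|(Pi\<^sub>M {..<rv_dim x} (\<lambda>_. lborel) \<Otimes>\<^sub>M Pi\<^sub>M {..<rv_dim y} (\<lambda>_. lborel)).
        (cmod (joint_char_fun M x y t s - char_fun M x t * char_fun M y s))\<^sup>2
          * dcov_weight (rv_dim x) (rv_dim y) t s)"

definition dcov_linkage ::
  "'w measure \<Rightarrow> 'w random_vector \<Rightarrow> 'w random_vector set \<Rightarrow> real" where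
  "dcov_linkage M x S = (\<Sum>y\<in>S. - distance_covariance M x y)"

definition monotone_linkage :: "'a set \<Rightarrow> ('a \<Rightarrow> 'a set \<Rightarrow> real) \<Rightarrow> bool" where
  "monotone_linkage X \<pi> \<longleftrightarrow>
     (\<forall>S \<in> Pow X - {{}, X}. \<forall>T \<in> Pow X - {{}, X}.
        S \<subseteq> T \<longrightarrow> (\<forall>x \<in> X - T. \<pi> x S \<ge> \<pi> x T))"

end

theory Submission imports Defs begin

text \<open>
  Enlarging \<open>S\<close> to \<open>T\<close> adds to the sum that defines the linkage the terms
  \<open>- \<nu>\<^sup>2(x, y)\<close> for \<open>y \<in> T - S\<close>, and each of them is at most \<open>0\<close>: the distance
  covariance integrates a squared modulus against a nonnegative weight. The weight is
  nonnegative because the constants \<open>c\<^sub>d\<close> divide by values of the Gamma function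
  at positive arguments.
\<close>

lemma dcov_const_pos: "dcov_const d > 0"
  unfolding dcov_const_def by (simp add: Gamma_real_pos)

lemma dcov_weight_nonneg: "dcov_weight d m t s \<ge> 0"
  unfolding dcov_weight_def using dcov_const_pos[of d] dcov_const_pos[of m] by simp

lemma distance_covariance_nonneg: "distance_covariance M x y \<ge> 0"
  unfolding distance_covariance_def
  by (rule Bochner_Integration.integral_nonneg) (auto simp: dcov_weight_nonneg)

lemma dcov_linkage_antimono:
  assumes "finite T" "S \<subseteq> T"
  shows "dcov_linkage M x T \<le> dcov_linkage M x S"
  unfolding dcov_linkage_def sum_negf neg_le_iff_le
  by (rule sum_mono2) (use assms distance_covariance_nonneg in auto)

theorem lemma8p1:
  fixes M :: "'w measure" and X :: "'w random_vector set"
  assumes "prob_space M"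
    and "finite X"
    and "\<And>x. x \<in> X \<Longrightarrow> is_random_vector M x"
    and "\<And>x. x \<in> X \<Longrightarrow> finite_first_moment M x"
  shows "monotone_linkage X (dcov_linkage M)"
  unfolding monotone_linkage_def
proof (intro ballI impI)
  fix S T x
  assume "T \<in> Pow X - {{}, X}" "S \<subseteq> T"
  moreover from this have "finite T"
    using \<open>finite X\<close> by (auto intro: finite_subset)
  ultimately show "dcov_linkage M x S \<ge> dcov_linkage M x T"
    by (simp add: dcov_linkage_antimono)
qed

end
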